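(* Let $a_0,\dots,a_7$ be real numbers and let $M$ be an $n$-dimensional $(N(k),\xi)$-semi-Riemannian manifold of constant curvature $k$. If $$a_0+a_1(n-1)+a_4(n-1)+a_7n(n-1)=0,$$ $$-a_0+a_2(n-1)+a_5(n-1)-a_7n(n-1)=0,$$ $$a_3+a_6=0,$$ then $M$ is $\mathcal{T}_a$-semisymmetric.
   Context: Let $(M,g)$ be an $n$-dimensional semi-Riemannian manifold with curvature tensor $R$, Ricci tensor $S$ (with $S(Y,Z)$ the trace of $X\mapsto R(X,Y)Z$), Ricci operator $Q$ ($g(QX,Y)=S(X,Y)$) and scalar curvature $r$. For real numbers $a_0,\dots,a_7$, the $\mathcal{T}_a$-curvature tensor is $$\mathcal{T}_a(X,Y)Z=a_0R(X,Y)Z+a_1S(Y,Z)X+a_2S(X,Z)Y+a_3S(X,Y)Z+a_4g(Y,Z)QX+a_5g(X,Z)QY+a_6g(X,Y)QZ+a_7r\,(g(Y,Z)X-g(X,Z)Y).$$ For a real number $k$, the $k$-nullity distribution is $N(k):p\mapsto\{Z\in T_pM: R(X,Y)Z=k(g(Y,Z)X-g(X,Z)Y)\text{ for all }X,Y\in T_pM\}$. An $(N(k),\xi)$-semi-Riemannian manifold is a semi-Riemannian manifold with a non-null unit vector field $\xi$ belonging to $N(k)$. Constant curvature $k$ means $R(X,Y)Z=k(g(Y,Z)X-g(X,Z)Y)$ for all $X,Y,Z$. $M$ is $\mathcal{T}_a$-semisymmetric if $R(X,Y)\cdot\mathcal{T}_a=0$ for all $X,Y$, where $R(X,Y)$ acts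 as a derivation on $\mathcal{T}_a$. *)

theory Defs
  imports "HOL-Analysis.Analysis" "HOL-Library.Function_Algebras"
begin

text \<open>Functions into a real vector space form a real vector space, with pointwise operations.
  Tangent vectors are such functions.\<close>

instantiation "fun" :: (type, scaleR) scaleR
begin
definition "scaleR r f = (\<lambda>x. r *\<^sub>R f x)"
instance ..
end

instance "fun" :: (type, real_vector) real_vector
  by standard (auto simp: scaleR_fun_def fun_eq_iff algebra_simps)

text \<open>The trace of an endomorphism \<open>L\<close> of a finite-dimensional subspace \<open>V\<close>,
  computed in some basis of \<open>V\<close> (the value does not depend on which).\<close>

definition endo_trace :: "'v::real_vector set \<Rightarrow> ('v \<Rightarrow> 'v) \<Rightarrow> real" where
  "endo_trace V L =
     (let B = (SOME B. independent B \<and> span B = V) in \<Sum>b\<in>B. representation B (L b) b)"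


section \<open>Smooth manifolds\<close>

fun Ck_on :: "nat \<Rightarrow> 'a::euclidean_space set \<Rightarrow> ('a \<Rightarrow> 'b::real_normed_vector) \<Rightarrow> bool" where
  "Ck_on 0 U f \<longleftrightarrow> continuous_on U f"
| "Ck_on (Suc k) U f \<longleftrightarrow>
     (\<forall>x\<in>U. f differentiable (at x)) \<and> (\<forall>v. Ck_on k U (\<lambda>x. frechet_derivative f (at x) v))"

definition smooth_on :: "'a::euclidean_space set \<Rightarrow> ('a \<Rightarrow> 'b::real_normed_vector) \<Rightarrow> bool" where
  "smooth_on U f \<longleftrightarrow> open U \<and> (\<forall>k. Ck_on k U f)"

text \<open>A chart is a pair of a domain and a coordinate map; only the values of the coordinate map
  on the domain matter. The dimension of the manifold is \<open>CARD('n)\<close>.\<close>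

type_synonym ('m, 'n) chart = "'m set \<times> ('m \<Rightarrow> real ^ 'n)"

definition inv_chart :: "('m, 'n) chart \<Rightarrow> real ^ 'n \<Rightarrow> 'm" where
  "inv_chart c = inv_into (fst c) (snd c)"

definition transition :: "('m, 'n) chart \<Rightarrow> ('m, 'n) chart \<Rightarrow> real ^ 'n \<Rightarrow> real ^ 'n" where
  "transition c d = snd d \<circ> inv_chart c"

definition smooth_atlas ::
    "('m::{t2_space, second_countable_topology}, 'n::finite) chart set \<Rightarrow> bool" where
  "smooth_atlas A \<longleftrightarrow>
     (\<forall>c\<in>A. open (fst c) \<and> open (snd c ` fst c) \<and>
            homeomorphism (fst c) (snd c ` fst c) (snd c) (inv_chart c)) \<and>
     (\<Union>c\<in>A. fst c) = UNIV \<and>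
     (\<forall>c\<in>A. \<forall>d\<in>A. smooth_on (snd c ` (fst c \<inter> fst d)) (transition c d))"

definition charts_at :: "('m, 'n) chart set \<Rightarrow> 'm \<Rightarrow> ('m, 'n) chart set" where
  "charts_at A p = {c\<in>A. p \<in> fst c}"

text \<open>A tangent vector at \<open>p\<close> is the family of its coordinate vectors in all charts around \<open>p\<close>,
  related by the Jacobians of the transition maps. At charts not around \<open>p\<close> the family
  is 0 by convention.\<close>

type_synonym ('m, 'n) tangent = "('m, 'n) chart \<Rightarrow> real ^ 'n"

definition tangent_space ::
    "('m, 'n::finite) chart set \<Rightarrow> 'm \<Rightarrow> ('m, 'n) tangent set" where
  "tangent_space A p =
     {v. (\<forall>c. c \<notin> charts_at A p \<longrightarrow> v c = 0) \<and>
         (\<forall>c\<in>charts_at A p. \<forall>d\<in>charts_at A p.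
            v d = frechet_derivative (transition c d) (at (snd c p)) (v c))}"

text \<open>The tangent vector at \<open>p\<close> with coordinate vector \<open>w\<close> in the chart \<open>c\<close>;
  for \<open>w = axis i 1\<close> this is the coordinate vector field \<open>\<partial>\<^sub>i\<close> at \<open>p\<close>.\<close>

definition from_coords ::
    "('m, 'n::finite) chart set \<Rightarrow> ('m, 'n) chart \<Rightarrow> 'm \<Rightarrow> real ^ 'n \<Rightarrow> ('m, 'n) tangent" where
  "from_coords A c p w =
     (\<lambda>d. if d \<in> charts_at A p then frechet_derivative (transition c d) (at (snd c p)) w else 0)"

definition smooth_vector_field ::
    "('m, 'n::finite) chart set \<Rightarrow> ('m \<Rightarrow> ('m, 'n) tangent) \<Rightarrow> bool" where
  "smooth_vector_field A \<xi> \<longleftrightarrow>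
     (\<forall>p. \<xi> p \<in> tangent_space A p) \<and>
     (\<forall>c\<in>A. smooth_on (snd c ` fst c) (\<lambda>x. \<xi> (inv_chart c x) c))"


section \<open>Semi-Riemannian metrics\<close>

type_synonym ('m, 'n) metric_field = "'m \<Rightarrow> ('m, 'n) tangent \<Rightarrow> ('m, 'n) tangent \<Rightarrow> real"

definition metric_matrix ::
    "('m, 'n::finite) chart set \<Rightarrow> ('m, 'n) metric_field \<Rightarrow> ('m, 'n) chart \<Rightarrow>
     real ^ 'n \<Rightarrow> real ^ 'n ^ 'n" where
  "metric_matrix A g c x =
     (let p = inv_chart c x in
      \<chi> i j. g p (from_coords A c p (axis i 1)) (from_coords A c p (axis j 1)))"

definition metric_index ::
    "('m, 'n::finite) chart set \<Rightarrow> ('m, 'n) metric_field \<Rightarrow> 'm \<Rightarrow> nat" where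
  "metric_index A g p =
     Max {dim W | W. subspace W \<and> W \<subseteq> tangent_space A p \<and> (\<forall>X\<in>W. X \<noteq> 0 \<longrightarrow> g p X X < 0)}"

definition semi_riemannian_metric ::
    "('m, 'n::finite) chart set \<Rightarrow> ('m, 'n) metric_field \<Rightarrow> bool" where
  "semi_riemannian_metric A g \<longleftrightarrow>
     (\<forall>p. \<forall>X\<in>tangent_space A p. \<forall>Y\<in>tangent_space A p. g p X Y = g p Y X) \<and>
     (\<forall>p. \<forall>X\<in>tangent_space A p. \<forall>Y\<in>tangent_space A p. \<forall>Z\<in>tangent_space A p. \<forall>a b.
        g p (a *\<^sub>R X + b *\<^sub>R Y) Z = a * g p X Z + b * g p Y Z) \<and>
     (\<forall>p. \<forall>X\<in>tangent_space A p. (\<forall>Y\<in>tangent_space A p. g p X Y = 0) \<longrightarrow> X = 0) \<and>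
     (\<exists>\<nu>. \<forall>p. metric_index A g p = \<nu>) \<and>
     (\<forall>c\<in>A. \<forall>i j. smooth_on (snd c ` fst c) (\<lambda>x. metric_matrix A g c x $ i $ j))"

definition semi_riemannian_manifold ::
    "('m::{t2_space, second_countable_topology}, 'n::finite) chart set \<Rightarrow>
     ('m, 'n) metric_field \<Rightarrow> bool" where
  "semi_riemannian_manifold A g \<longleftrightarrow> smooth_atlas A \<and> semi_riemannian_metric A g"


section \<open>Levi-Civita connection and curvature\<close>

text \<open>\<open>christoffel A g c k i j\<close> is \<open>\<Gamma>\<^sup>k\<^sub>i\<^sub>j\<close>, as a function on the image of the chart \<open>c\<close>.\<close>

definition christoffel ::
    "('m, 'n::finite) chart set \<Rightarrow> ('m, 'n) metric_field \<Rightarrow> ('m, 'n) chart \<Rightarrow>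
     'n \<Rightarrow> 'n \<Rightarrow> 'n \<Rightarrow> real ^ 'n \<Rightarrow> real" where
  "christoffel A g c k i j x =
     (let G = metric_matrix A g c;
          dG = (\<lambda>l a b. frechet_derivative (\<lambda>y. G y $ a $ b) (at x) (axis l 1))
      in 1/2 * (\<Sum>l\<in>UNIV. matrix_inv (G x) $ k $ l * (dG i j l + dG j i l - dG l i j)))"

text \<open>The Levi-Civita connection and the Lie bracket, for vector fields on the image of a chart.\<close>

definition nabla ::
    "('m, 'n::finite) chart set \<Rightarrow> ('m, 'n) metric_field \<Rightarrow> ('m, 'n) chart \<Rightarrow>
     (real ^ 'n \<Rightarrow> real ^ 'n) \<Rightarrow> (real ^ 'n \<Rightarrow> real ^ 'n) \<Rightarrow> real ^ 'n \<Rightarrow> real ^ 'n" where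
  "nabla A g c X Y x =
     frechet_derivative Y (at x) (X x) +
     (\<chi> k. \<Sum>i\<in>UNIV. \<Sum>j\<in>UNIV. christoffel A g c k i j x * X x $ i * Y x $ j)"

definition lie_bracket ::
    "(real ^ 'n::finite \<Rightarrow> real ^ 'n) \<Rightarrow> (real ^ 'n \<Rightarrow> real ^ 'n) \<Rightarrow> real ^ 'n \<Rightarrow> real ^ 'n" where
  "lie_bracket X Y x =
     frechet_derivative Y (at x) (X x) - frechet_derivative X (at x) (Y x)"

definition curvature_coords ::
    "('m, 'n::finite) chart set \<Rightarrow> ('m, 'n) metric_field \<Rightarrow> ('m, 'n) chart \<Rightarrow>
     (real ^ 'n \<Rightarrow> real ^ 'n) \<Rightarrow> (real ^ 'n \<Rightarrow> real ^ 'n) \<Rightarrow> (real ^ 'n \<Rightarrow> real ^ 'n) \<Rightarrow>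
     real ^ 'n \<Rightarrow> real ^ 'n" where
  "curvature_coords A g c X Y Z x =
     nabla A g c X (nabla A g c Y Z) x - nabla A g c Y (nabla A g c X Z) x
     - nabla A g c (lie_bracket X Y) Z x"

text \<open>\<open>R(X,Y)Z\<close> at \<open>p\<close>. Curvature is tensorial, so in each chart the tangent vectors may be
  extended to the vector fields with constant coordinates.\<close>

definition curvature ::
    "('m, 'n::finite) chart set \<Rightarrow> ('m, 'n) metric_field \<Rightarrow> 'm \<Rightarrow>
     ('m, 'n) tangent \<Rightarrow> ('m, 'n) tangent \<Rightarrow> ('m, 'n) tangent \<Rightarrow> ('m, 'n) tangent" where
  "curvature A g p X Y Z =
     (\<lambda>c. if c \<in> charts_at A p
          then curvature_coords A g c (\<lambda>_. X c) (\<lambda>_. Y c) (\<lambda>_. Z c) (snd c p) else 0)"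

definition ricci ::
    "('m, 'n::finite) chart set \<Rightarrow> ('m, 'n) metric_field \<Rightarrow> 'm \<Rightarrow>
     ('m, 'n) tangent \<Rightarrow> ('m, 'n) tangent \<Rightarrow> real" where
  "ricci A g p Y Z = endo_trace (tangent_space A p) (\<lambda>X. curvature A g p X Y Z)"

definition ricci_operator ::
    "('m, 'n::finite) chart set \<Rightarrow> ('m, 'n) metric_field \<Rightarrow> 'm \<Rightarrow>
     ('m, 'n) tangent \<Rightarrow> ('m, 'n) tangent" where
  "ricci_operator A g p X =
     (THE W. W \<in> tangent_space A p \<and> (\<forall>Y\<in>tangent_space A p. g p W Y = ricci A g p X Y))"

definition scalar_curvature ::
    "('m, 'n::finite) chart set \<Rightarrow> ('m, 'n) metric_field \<Rightarrow> 'm \<Rightarrow> real" where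
  "scalar_curvature A g p = endo_trace (tangent_space A p) (ricci_operator A g p)"

definition constant_curvature ::
    "('m, 'n::finite) chart set \<Rightarrow> ('m, 'n) metric_field \<Rightarrow> real \<Rightarrow> bool" where
  "constant_curvature A g k \<longleftrightarrow>
     (\<forall>p. \<forall>X\<in>tangent_space A p. \<forall>Y\<in>tangent_space A p. \<forall>Z\<in>tangent_space A p.
        curvature A g p X Y Z = k *\<^sub>R (g p Y Z *\<^sub>R X - g p X Z *\<^sub>R Y))"

definition nullity_distribution ::
    "('m, 'n::finite) chart set \<Rightarrow> ('m, 'n) metric_field \<Rightarrow> real \<Rightarrow> 'm \<Rightarrow>
     ('m, 'n) tangent set" where
  "nullity_distribution A g k p =
     {Z \<in> tangent_space A p. \<forall>X\<in>tangent_space A p. \<forall>Y\<in>tangent_space A p.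
        curvature A g p X Y Z = k *\<^sub>R (g p Y Z *\<^sub>R X - g p X Z *\<^sub>R Y)}"

text \<open>Since \<open>\<bar>g(\<xi>,\<xi>)\<bar> = 1\<close>, a unit vector field is automatically non-null.\<close>

definition Nk_semi_riemannian_manifold ::
    "('m::{t2_space, second_countable_topology}, 'n::finite) chart set \<Rightarrow>
     ('m, 'n) metric_field \<Rightarrow> real \<Rightarrow> ('m \<Rightarrow> ('m, 'n) tangent) \<Rightarrow> bool" where
  "Nk_semi_riemannian_manifold A g k \<xi> \<longleftrightarrow>
     semi_riemannian_manifold A g \<and> smooth_vector_field A \<xi> \<and>
     (\<forall>p. \<bar>g p (\<xi> p) (\<xi> p)\<bar> = 1) \<and> (\<forall>p. \<xi> p \<in> nullity_distribution A g k p)"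


section \<open>The \<open>T\<^sub>a\<close>-curvature tensor\<close>

text \<open>Only the coefficients \<open>a 0, \<dots>, a 7\<close> are used.\<close>

definition Ta_curvature ::
    "('m, 'n::finite) chart set \<Rightarrow> ('m, 'n) metric_field \<Rightarrow> (nat \<Rightarrow> real) \<Rightarrow> 'm \<Rightarrow>
     ('m, 'n) tangent \<Rightarrow> ('m, 'n) tangent \<Rightarrow> ('m, 'n) tangent \<Rightarrow> ('m, 'n) tangent" where
  "Ta_curvature A g a p X Y Z =
     (let S = ricci A g p; Q = ricci_operator A g p; r = scalar_curvature A g p in
      a 0 *\<^sub>R curvature A g p X Y Z
      + (a 1 * S Y Z) *\<^sub>R X + (a 2 * S X Z) *\<^sub>R Y + (a 3 * S X Y) *\<^sub>R Z
      + (a 4 * g p Y Z) *\<^sub>R Q X + (a 5 * g p X Z) *\<^sub>R Q Y + (a 6 * g p X Y) *\<^sub>R Q Z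
      + (a 7 * r) *\<^sub>R (g p Y Z *\<^sub>R X - g p X Z *\<^sub>R Y))"

text \<open>\<open>(D \<cdot> T)(U,V)W\<close> for an endomorphism \<open>D\<close> acting as a derivation on a tensor \<open>T\<close> of
  type \<open>(1,3)\<close>.\<close>

definition derivation_action ::
    "('v::real_vector \<Rightarrow> 'v) \<Rightarrow> ('v \<Rightarrow> 'v \<Rightarrow> 'v \<Rightarrow> 'v) \<Rightarrow> 'v \<Rightarrow> 'v \<Rightarrow> 'v \<Rightarrow> 'v" where
  "derivation_action D T U V W = D (T U V W) - T (D U) V W - T U (D V) W - T U V (D W)"

definition Ta_semisymmetric ::
    "('m, 'n::finite) chart set \<Rightarrow> ('m, 'n) metric_field \<Rightarrow> (nat \<Rightarrow> real) \<Rightarrow> bool" where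
  "Ta_semisymmetric A g a \<longleftrightarrow>
     (\<forall>p. \<forall>X\<in>tangent_space A p. \<forall>Y\<in>tangent_space A p.
        \<forall>U\<in>tangent_space A p. \<forall>V\<in>tangent_space A p. \<forall>W\<in>tangent_space A p.
          derivation_action (curvature A g p X Y) (Ta_curvature A g a p) U V W = 0)"

end

theory Submission
  imports Defs
begin

text \<open>In constant curvature \<open>k\<close>, tracing \<open>X \<mapsto> k (g(Y,Z) X - g(X,Z) Y)\<close> gives
  \<open>S = k (n - 1) g\<close>, hence \<open>Q = k (n - 1) I\<close> and \<open>r = k n (n - 1)\<close>. Therefore
  \<open>T\<^sub>a(X,Y)Z\<close> is a combination of \<open>g(Y,Z) X\<close>, \<open>g(X,Z) Y\<close> and \<open>g(X,Y) Z\<close>, whose coefficients are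
  \<open>k\<close> times the left-hand sides of the first two conditions and \<open>k (n - 1) (a 3 + a 6)\<close>. So
  \<open>T\<^sub>a = 0\<close> on tangent vectors. Since \<open>R(X,Y)\<close> preserves the tangent space and vanishes at 0,
  every term of its derivation action on \<open>T\<^sub>a\<close> is zero.

  The traces require that the tangent space, encoded as a space of compatible families of
  coordinate vectors, has dimension \<open>n\<close>: by the chain rule for transition maps, \<open>from_coords\<close>
  in a chart around \<open>p\<close> is a linear isomorphism from the coordinate space onto it. The trace
  of a multiple of the identity plus a rank-one map is then computed in an arbitrary basis.\<close>

section \<open>Trace of a rank-one perturbation of a homothety\<close>

text \<open>The endomorphisms traced below have the form \<open>c I + \<phi> \<otimes> Y\<close> on the tangent space. Since
  \<open>endo_trace\<close> picks its basis \<open>B\<close> by choice, the argument is for an arbitrary basis: the diagonal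
  entry at \<open>b\<close> is \<open>c + \<phi>(b) Y\<^sub>b\<close>, and \<open>\<Sum>b\<in>B. \<phi>(b) Y\<^sub>b = \<phi>(Y)\<close>.\<close>

lemma endo_trace_scale_plus_rank_one:
  fixes V :: "'v::real_vector set"
  assumes V: "V = span S" "finite S"
    and Y: "Y \<in> V"
    and \<phi>: "\<And>X Z s t. X \<in> V \<Longrightarrow> Z \<in> V \<Longrightarrow> \<phi> (s *\<^sub>R X + t *\<^sub>R Z) = s * \<phi> X + t * \<phi> Z"
    and L: "\<And>X. X \<in> V \<Longrightarrow> L X = c *\<^sub>R X + \<phi> X *\<^sub>R Y"
  shows "endo_trace V L = c * real (dim V) + \<phi> Y"
proof -
  define B where "B = (SOME B. independent B \<and> span B = V)"
  have "subspace V"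
    unfolding V(1) by (rule subspace_span)
  then have "\<exists>B. independent B \<and> span B = V"
    using basis_exists[of V] span_subspace by metis
  then have B: "independent B" "span B = V"
    unfolding B_def using someI_ex[of "\<lambda>B. independent B \<and> span B = V"] by auto
  have BV: "B \<subseteq> V"
    using B(2) span_superset by blast
  have fin: "finite B"
    using independent_span_bound[OF V(2) B(1)] BV V(1) by auto
  have card: "card B = dim V"
    using dim_eq_card_independent[OF B(1)] dim_span[of B] B(2) by simp
  have \<phi>_sum: "\<phi> (\<Sum>b\<in>F. f b *\<^sub>R b) = (\<Sum>b\<in>F. f b * \<phi> b)" if "F \<subseteq> B" for F f
    using finite_subset[OF that fin] that
  proof (induction F)
    case empty
    show ?case using \<phi>[OF Y Y, of 0 0] by simp
  next
    case (insert b F)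
    have "(\<Sum>b\<in>F. f b *\<^sub>R b) \<in> V"
      using insert.prems BV \<open>subspace V\<close> by (intro subspace_sum subspace_scale) auto
    then show ?case
      using insert \<phi>[of b "\<Sum>b\<in>F. f b *\<^sub>R b" "f b" 1] BV by auto
  qed
  have "representation B (L b) b = c + \<phi> b * representation B Y b" if "b \<in> B" for b
  proof -
    have "b \<in> span B" "Y \<in> span B" using that BV Y B(2) by auto
    then show ?thesis
      using L[of b] that BV B(1)
      by (subst L) (auto simp: representation_add representation_scale span_scale
          representation_basis)
  qed
  then have "endo_trace V L = (\<Sum>b\<in>B. c + \<phi> b * representation B Y b)"
    unfolding endo_trace_def Let_def B_def[symmetric] by simp
  also have "\<dots> = c * real (dim V) + (\<Sum>b\<in>B. representation B Y b * \<phi> b)"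
    by (simp add: sum.distrib card mult.commute)
  also have "(\<Sum>b\<in>B. representation B Y b * \<phi> b) = \<phi> Y"
    using \<phi>_sum[of B "representation B Y"] sum_representation_eq[OF B(1) _ fin order_refl, of Y]
      Y B(2) by simp
  finally show ?thesis .
qed

section \<open>The dimension of the tangent space\<close>

lemma transition_has_derivative:
  assumes "smooth_atlas A" "c \<in> charts_at A p" "d \<in> charts_at A p"
  shows "(transition c d has_derivative frechet_derivative (transition c d) (at (snd c p)))
           (at (snd c p))"
proof -
  have "smooth_on (snd c ` (fst c \<inter> fst d)) (transition c d)"
    and "snd c p \<in> snd c ` (fst c \<inter> fst d)"
    using assms unfolding smooth_atlas_def charts_at_def by auto
  then have "transition c d differentiable (at (snd c p))"
    unfolding smooth_on_def by (metis Ck_on.simps(2))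
  then show ?thesis
    by (simp add: frechet_derivative_works)
qed

lemma inv_chart_apply:
  assumes "smooth_atlas A" "c \<in> A" "q \<in> fst c"
  shows "inv_chart c (snd c q) = q"
  using assms unfolding smooth_atlas_def homeomorphism_def by blast

lemma open_chart_overlap:
  assumes "smooth_atlas A" "c \<in> A" "d \<in> A"
  shows "open (snd c ` (fst c \<inter> fst d))"
  using assms unfolding smooth_atlas_def smooth_on_def by blast

lemma frechet_derivative_transition_self:
  assumes A: "smooth_atlas A" and c: "c \<in> charts_at A p"
  shows "frechet_derivative (transition c c) (at (snd c p)) = (\<lambda>w. w)"
proof -
  have "c \<in> A" "p \<in> fst c" using c by (auto simp: charts_at_def)
  have "((\<lambda>x. x) has_derivative (\<lambda>w. w)) (at (snd c p))"
    by simp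
  then have "(transition c c has_derivative (\<lambda>w. w)) (at (snd c p))"
  proof (rule has_derivative_transform_within_open)
    show "open (snd c ` (fst c \<inter> fst c))"
      using open_chart_overlap A \<open>c \<in> A\<close> by blast
  qed (use \<open>p \<in> fst c\<close> inv_chart_apply[OF A \<open>c \<in> A\<close>] in \<open>auto simp: transition_def\<close>)
  then show ?thesis
    by (rule frechet_derivative_at[symmetric])
qed

text \<open>The cocycle identity for the Jacobians, that is, the chain rule for
  \<open>transition c e = transition d e \<circ> transition c d\<close> near \<open>snd c p\<close>.\<close>

lemma frechet_derivative_transition_compose:
  assumes A: "smooth_atlas A"
    and c: "c \<in> charts_at A p" and d: "d \<in> charts_at A p" and e: "e \<in> charts_at A p"
  shows "frechet_derivative (transition d e) (at (snd d p))
           (frechet_derivative (transition c d) (at (snd c p)) w) =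
         frechet_derivative (transition c e) (at (snd c p)) w"
proof -
  let ?D = "\<lambda>c d. frechet_derivative (transition c d) (at (snd c p))"
  have m: "c \<in> A" "p \<in> fst c" "d \<in> A" "p \<in> fst d" using c d by (auto simp: charts_at_def)
  have "transition c d (snd c p) = snd d p"
    using m inv_chart_apply[OF A] by (simp add: transition_def)
  then have "(transition d e has_derivative ?D d e) (at (transition c d (snd c p)))"
    using transition_has_derivative[OF A d e] by simp
  with transition_has_derivative[OF A c d]
  have "(transition d e \<circ> transition c d has_derivative ?D d e \<circ> ?D c d) (at (snd c p))"
    by (rule diff_chain_at)
  then have "(transition c e has_derivative ?D d e \<circ> ?D c d) (at (snd c p))"
  proof (rule has_derivative_transform_within_open)
    show "open (snd c ` (fst c \<inter> fst d))"
      using open_chart_overlap A m by blast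
  qed (use m inv_chart_apply[OF A \<open>c \<in> A\<close>] inv_chart_apply[OF A \<open>d \<in> A\<close>]
      in \<open>auto simp: transition_def\<close>)
  then have "?D c e = ?D d e \<circ> ?D c d"
    by (rule frechet_derivative_at[symmetric])
  then show ?thesis by simp
qed

text \<open>A tangent vector is determined by its coordinates in one chart, and the cocycle identity
  makes every coordinate vector extend to a compatible family.\<close>

lemma tangent_space_eq_range_from_coords:
  assumes A: "smooth_atlas A" and c: "c \<in> charts_at A p"
  shows "tangent_space A p = range (from_coords A c p)"
proof (intro set_eqI iffI)
  fix v assume v: "v \<in> tangent_space A p"
  then have "v = from_coords A c p (v c)"
  proof (intro ext)
    fix d
    have "d \<notin> charts_at A p \<longrightarrow> v d = 0"
      and "d \<in> charts_at A p \<longrightarrow>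
        v d = frechet_derivative (transition c d) (at (snd c p)) (v c)"
      using v c unfolding tangent_space_def by blast+
    then show "v d = from_coords A c p (v c) d"
      unfolding from_coords_def by presburger
  qed
  then show "v \<in> range (from_coords A c p)" by blast
next
  fix v assume "v \<in> range (from_coords A c p)"
  then obtain w where v: "v = from_coords A c p w" by blast
  show "v \<in> tangent_space A p"
    unfolding v tangent_space_def from_coords_def
    by (simp add: frechet_derivative_transition_compose[OF A c])
qed

lemma linear_from_coords:
  assumes A: "smooth_atlas A" and c: "c \<in> charts_at A p"
  shows "linear (from_coords A c p)"
proof -
  have lin: "linear (frechet_derivative (transition c d) (at (snd c p)))"
    if "d \<in> charts_at A p" for d
    using transition_has_derivative[OF A c that] by (rule has_derivative_linear)
  show ?thesis
    by (rule linearI)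
      (auto simp: from_coords_def fun_eq_iff scaleR_fun_def linear_add[OF lin] linear_cmul[OF lin])
qed

lemma inj_from_coords:
  assumes A: "smooth_atlas A" and c: "c \<in> charts_at A p"
  shows "inj (from_coords A c p)"
proof (rule inj_on_inverseI)
  show "from_coords A c p w c = w" for w
    using c by (simp add: from_coords_def frechet_derivative_transition_self[OF A c])
qed

lemma tangent_space_finite_basis:
  fixes A :: "('m::{t2_space, second_countable_topology}, 'n::finite) chart set"
  assumes A: "smooth_atlas A"
  obtains S where "finite S" "tangent_space A p = span S" "dim (tangent_space A p) = CARD('n)"
proof -
  obtain c where c: "c \<in> charts_at A p"
    using A unfolding smooth_atlas_def charts_at_def by blast
  let ?S = "from_coords A c p ` Basis"
  note lin = linear_from_coords[OF A c] and inj = inj_from_coords[OF A c]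
  have span: "span ?S = tangent_space A p"
    using linear_span_image[OF lin, of Basis] tangent_space_eq_range_from_coords[OF A c] by simp
  have "independent ?S"
    using linear_independent_injective_image[OF lin independent_Basis] inj
    by (simp add: inj_on_subset)
  then have "dim (tangent_space A p) = card ?S"
    using dim_eq_card_independent[of ?S] dim_span[of ?S] span by simp
  also have "\<dots> = CARD('n)"
    using card_image[OF inj_on_subset[OF inj subset_UNIV], of Basis] by simp
  finally show thesis
    using that[of ?S] span by simp
qed

section \<open>Curvature quantities in constant curvature\<close>

text \<open>The linear algebra behind the formula for \<open>T\<^sub>a\<close>, with \<open>yz\<close>, \<open>xz\<close>, \<open>xy\<close> standing for
  \<open>g(Y,Z)\<close>, \<open>g(X,Z)\<close>, \<open>g(X,Y)\<close>.\<close>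

lemma collect_Ta_terms:
  fixes X Y Z :: "'v::real_vector" and n :: real
  shows "a0 *\<^sub>R (k *\<^sub>R (yz *\<^sub>R X - xz *\<^sub>R Y))
      + (a1 * (k * (n - 1) * yz)) *\<^sub>R X + (a2 * (k * (n - 1) * xz)) *\<^sub>R Y
      + (a3 * (k * (n - 1) * xy)) *\<^sub>R Z
      + (a4 * yz) *\<^sub>R ((k * (n - 1)) *\<^sub>R X) + (a5 * xz) *\<^sub>R ((k * (n - 1)) *\<^sub>R Y)
      + (a6 * xy) *\<^sub>R ((k * (n - 1)) *\<^sub>R Z)
      + (a7 * (k * n * (n - 1))) *\<^sub>R (yz *\<^sub>R X - xz *\<^sub>R Y) =
     (k * (a0 + a1 * (n - 1) + a4 * (n - 1) + a7 * n * (n - 1)) * yz) *\<^sub>R X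
     + (k * (- a0 + a2 * (n - 1) + a5 * (n - 1) - a7 * n * (n - 1)) * xz) *\<^sub>R Y
     + (k * (n - 1) * (a3 + a6) * xy) *\<^sub>R Z"
  by (simp add: algebra_simps)

context
  fixes A :: "('m::{t2_space, second_countable_topology}, 'n::finite) chart set"
    and g :: "('m, 'n) metric_field" and k :: real
  assumes M: "semi_riemannian_manifold A g"
    and K: "constant_curvature A g k"
begin

private lemma atlas: "smooth_atlas A"
  using M by (simp add: semi_riemannian_manifold_def)

private lemma subspace_tangent_space: "subspace (tangent_space A p)"
proof -
  obtain S where "tangent_space A p = span S"
    using tangent_space_finite_basis[OF atlas] by blast
  then show ?thesis by simp
qed

private lemmas metric =
  conjunct2[OF M[unfolded semi_riemannian_manifold_def], unfolded semi_riemannian_metric_def]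

private lemma metric_linear_left:
  assumes "X \<in> tangent_space A p" "Y \<in> tangent_space A p" "Z \<in> tangent_space A p"
  shows "g p (s *\<^sub>R X + t *\<^sub>R Y) Z = s * g p X Z + t * g p Y Z"
  using conjunct1[OF conjunct2[OF metric]] assms by simp

private lemma metric_sym:
  assumes "X \<in> tangent_space A p" "Y \<in> tangent_space A p"
  shows "g p X Y = g p Y X"
  using conjunct1[OF metric] assms by simp

private lemma metric_nondegenerate:
  assumes "X \<in> tangent_space A p" "\<And>Y. Y \<in> tangent_space A p \<Longrightarrow> g p X Y = 0"
  shows "X = 0"
  using conjunct1[OF conjunct2[OF conjunct2[OF metric]]] assms by simp

private lemma curvature_eq:
  assumes "X \<in> tangent_space A p" "Y \<in> tangent_space A p" "Z \<in> tangent_space A p"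
  shows "curvature A g p X Y Z = k *\<^sub>R (g p Y Z *\<^sub>R X - g p X Z *\<^sub>R Y)"
  using K[unfolded constant_curvature_def] assms by simp

lemma ricci_constant_curvature:
  assumes Y: "Y \<in> tangent_space A p" and Z: "Z \<in> tangent_space A p"
  shows "ricci A g p Y Z = k * (real CARD('n) - 1) * g p Y Z"
proof -
  obtain S where S: "finite S" "tangent_space A p = span S" "dim (tangent_space A p) = CARD('n)"
    using tangent_space_finite_basis[OF atlas] .
  have "ricci A g p Y Z = (k * g p Y Z) * real (dim (tangent_space A p)) + - k * g p Y Z"
    unfolding ricci_def
  proof (rule endo_trace_scale_plus_rank_one[OF S(2,1) Y])
    show "- k * g p (s *\<^sub>R X + t *\<^sub>R X') Z = s * (- k * g p X Z) + t * (- k * g p X' Z)"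
      if "X \<in> tangent_space A p" "X' \<in> tangent_space A p" for X X' s t
      using metric_linear_left[OF that Z] by (simp add: algebra_simps)
    show "curvature A g p X Y Z = (k * g p Y Z) *\<^sub>R X + (- k * g p X Z) *\<^sub>R Y"
      if "X \<in> tangent_space A p" for X
      using curvature_eq[OF that Y Z] by (simp add: scaleR_diff_right)
  qed
  then show ?thesis by (simp add: S(3) algebra_simps)
qed

lemma ricci_operator_constant_curvature:
  assumes X: "X \<in> tangent_space A p"
  shows "ricci_operator A g p X = (k * (real CARD('n) - 1)) *\<^sub>R X"
  unfolding ricci_operator_def
proof (rule the_equality)
  let ?c = "k * (real CARD('n) - 1)"
  have cX: "?c *\<^sub>R X \<in> tangent_space A p"
    using subspace_scale[OF subspace_tangent_space X] .
  have g_cX: "g p (?c *\<^sub>R X) Y = ricci A g p X Y" if "Y \<in> tangent_space A p" for Y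
    using metric_linear_left[OF X X that, of ?c 0] ricci_constant_curvature[OF X that] by simp
  show "?c *\<^sub>R X \<in> tangent_space A p \<and>
      (\<forall>Y\<in>tangent_space A p. g p (?c *\<^sub>R X) Y = ricci A g p X Y)"
    using cX g_cX by blast
  fix W
  assume W: "W \<in> tangent_space A p \<and> (\<forall>Y\<in>tangent_space A p. g p W Y = ricci A g p X Y)"
  have "W - ?c *\<^sub>R X = 0"
  proof (rule metric_nondegenerate)
    show "W - ?c *\<^sub>R X \<in> tangent_space A p"
      using W cX subspace_diff[OF subspace_tangent_space] by blast
    show "g p (W - ?c *\<^sub>R X) Y = 0" if "Y \<in> tangent_space A p" for Y
    proof -
      have "g p (W - ?c *\<^sub>R X) Y = g p W Y - g p (?c *\<^sub>R X) Y"
        using metric_linear_left[OF conjunct1[OF W] cX that, of 1 "- 1"] by simp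
      also have "\<dots> = 0"
        using bspec[OF conjunct2[OF W] that] g_cX[OF that] by (simp only: diff_self)
      finally show ?thesis .
    qed
  qed
  then show "W = ?c *\<^sub>R X" by simp
qed

lemma scalar_curvature_constant_curvature:
  "scalar_curvature A g p = k * real CARD('n) * (real CARD('n) - 1)"
proof -
  obtain S where S: "finite S" "tangent_space A p = span S" "dim (tangent_space A p) = CARD('n)"
    using tangent_space_finite_basis[OF atlas] .
  have "scalar_curvature A g p =
      (k * (real CARD('n) - 1)) * real (dim (tangent_space A p)) + 0"
    unfolding scalar_curvature_def
  proof (rule endo_trace_scale_plus_rank_one[OF S(2,1) subspace_0[OF subspace_tangent_space],
        where \<phi> = "\<lambda>_. 0"])
    show "ricci_operator A g p X = (k * (real CARD('n) - 1)) *\<^sub>R X + 0 *\<^sub>R 0"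
      if "X \<in> tangent_space A p" for X
      unfolding ricci_operator_constant_curvature[OF that] by simp
  qed simp
  then show ?thesis by (simp add: S(3) algebra_simps)
qed

lemma Ta_curvature_constant_curvature:
  fixes a :: "nat \<Rightarrow> real"
  assumes X: "X \<in> tangent_space A p" and Y: "Y \<in> tangent_space A p"
    and Z: "Z \<in> tangent_space A p"
  defines "n \<equiv> real CARD('n)"
  shows "Ta_curvature A g a p X Y Z =
     (k * (a 0 + a 1 * (n - 1) + a 4 * (n - 1) + a 7 * n * (n - 1)) * g p Y Z) *\<^sub>R X
     + (k * (- a 0 + a 2 * (n - 1) + a 5 * (n - 1) - a 7 * n * (n - 1)) * g p X Z) *\<^sub>R Y
     + (k * (n - 1) * (a 3 + a 6) * g p X Y) *\<^sub>R Z"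
  unfolding Ta_curvature_def Let_def n_def curvature_eq[OF X Y Z]
    ricci_constant_curvature[OF Y Z] ricci_constant_curvature[OF X Z]
    ricci_constant_curvature[OF X Y] ricci_operator_constant_curvature[OF X]
    ricci_operator_constant_curvature[OF Y] ricci_operator_constant_curvature[OF Z]
    scalar_curvature_constant_curvature
  by (rule collect_Ta_terms)

lemma curvature_in_tangent_space:
  assumes "X \<in> tangent_space A p" "Y \<in> tangent_space A p" "Z \<in> tangent_space A p"
  shows "curvature A g p X Y Z \<in> tangent_space A p"
  unfolding curvature_eq[OF assms]
  by (intro subspace_scale subspace_diff subspace_tangent_space assms)

text \<open>\<open>curvature\<close> is defined in coordinates, so its vanishing at 0 is read off from the
  constant-curvature formula rather than from linearity.\<close>

lemma curvature_zero_right: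
  assumes X: "X \<in> tangent_space A p" and Y: "Y \<in> tangent_space A p"
  shows "curvature A g p X Y 0 = 0"
proof -
  have 0: "0 \<in> tangent_space A p"
    using subspace_0[OF subspace_tangent_space] .
  have g0: "g p U 0 = 0" if "U \<in> tangent_space A p" for U
  proof -
    have "g p 0 U = 0"
      using metric_linear_left[OF 0 0 that, of 0 0] by simp
    then show ?thesis
      by (simp only: metric_sym[OF that 0])
  qed
  show ?thesis
    unfolding curvature_eq[OF X Y 0] g0[OF X] g0[OF Y] by simp
qed

end

section \<open>Semisymmetry\<close>

theorem theorem6p26:
  fixes A :: "('m::{t2_space, second_countable_topology}, 'n::finite) chart set"
    and g :: "('m, 'n) metric_field"
    and \<xi> :: "'m \<Rightarrow> ('m, 'n) tangent"
    and a :: "nat \<Rightarrow> real" and k :: real and n :: nat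
  assumes "n = CARD('n)"
    and "Nk_semi_riemannian_manifold A g k \<xi>"
    and "constant_curvature A g k"
    and "a 0 + a 1 * (real n - 1) + a 4 * (real n - 1) + a 7 * real n * (real n - 1) = 0"
    and "- a 0 + a 2 * (real n - 1) + a 5 * (real n - 1) - a 7 * real n * (real n - 1) = 0"
    and "a 3 + a 6 = 0"
  shows "Ta_semisymmetric A g a"
proof -
  have M: "semi_riemannian_manifold A g"
    using assms(2) by (simp add: Nk_semi_riemannian_manifold_def)
  note K = assms(3)
  have Ta_zero: "Ta_curvature A g a p U V W = 0"
    if "U \<in> tangent_space A p" "V \<in> tangent_space A p" "W \<in> tangent_space A p" for p U V W
    unfolding Ta_curvature_constant_curvature[OF M K that] assms(4-6)[unfolded assms(1)]
    by simp
  show ?thesis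
    unfolding Ta_semisymmetric_def
  proof (intro allI ballI)
    fix p X Y U V W
    assume XY: "X \<in> tangent_space A p" "Y \<in> tangent_space A p"
      and UVW: "U \<in> tangent_space A p" "V \<in> tangent_space A p" "W \<in> tangent_space A p"
    note R = curvature_in_tangent_space[OF M K XY]
    show "derivation_action (curvature A g p X Y) (Ta_curvature A g a p) U V W = 0"
      unfolding derivation_action_def Ta_zero[OF UVW] Ta_zero[OF R[OF UVW(1)] UVW(2,3)]
        Ta_zero[OF UVW(1) R[OF UVW(2)] UVW(3)] Ta_zero[OF UVW(1,2) R[OF UVW(3)]]
        curvature_zero_right[OF M K XY]
      by simp
  qed
qed

end
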